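(* Let $K_{m,n}$ be a complete bipartite graph with $1<m\le n$. (i) If $m<n$, then $\operatorname{st}_{\gamma_{st}}(K_{m,n})=1$. (ii) If $m=n\ge 4$, then $\operatorname{st}_{\gamma_{st}}(K_{n,n})=1$.
   Context: All graphs are finite, simple and undirected. For a graph $G=(V,E)$, a set $D\subseteq V$ is a strong dominating set if every vertex $v\in V\setminus D$ is adjacent to some $u\in D$ with $\deg(v)\le\deg(u)$ (degrees taken in $G$). The strong domination number $\gamma_{st}(G)$ is the minimum size of a strong dominating set. For $S\subseteq V$, $G-S$ is the graph obtained by deleting the vertices of $S$. The stability of the strong domination number is $\operatorname{st}_{\gamma_{st}}(G)=\min\{|S| : S\subseteq V,\ \gamma_{st}(G-S)\ne\gamma_{st}(G)\}$. *)

theory Defs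
  imports "Graph_Theory.Graph_Theory"
begin

text \<open>
  A finite simple undirected graph is a digraph satisfying the locale \<^locale>\<open>graph\<close>, i.e. a finite
  symmetric digraph without loops and parallel arcs. Each undirected edge is a pair of opposite
  arcs, so the degree of a vertex is its out-degree.
\<close>

lemma (in graph) out_degree_eq_card_neighbours:
  "out_degree G v = card {u. v \<rightarrow>\<^bsub>G\<^esub> u}"
proof -
  have "bij_betw (head G) (out_arcs G v) {u. v \<rightarrow>\<^bsub>G\<^esub> u}"
    unfolding bij_betw_def
  proof
    show "inj_on (head G) (out_arcs G v)"
      by (auto intro!: inj_onI no_multi_arcs simp: out_arcs_def arc_to_ends_def)
    show "head G ` out_arcs G v = {u. v \<rightarrow>\<^bsub>G\<^esub> u}"
      by (auto simp: out_arcs_def arcs_ends_def arc_to_ends_def)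
  qed
  then show ?thesis
    unfolding out_degree_def by (rule bij_betw_same_card)
qed

definition strong_dominating_set :: "('a, 'b) pre_digraph \<Rightarrow> 'a set \<Rightarrow> bool" where
  "strong_dominating_set G D \<longleftrightarrow>
     D \<subseteq> verts G \<and>
     (\<forall>v \<in> verts G - D. \<exists>u \<in> D. v \<rightarrow>\<^bsub>G\<^esub> u \<and> out_degree G v \<le> out_degree G u)"

text \<open>The graph without vertices is allowed; its strong domination number is 0.\<close>

definition strong_domination_number :: "('a, 'b) pre_digraph \<Rightarrow> nat" where
  "strong_domination_number G = Min {card D | D. strong_dominating_set G D}"

definition delete_vertices :: "('a, 'b) pre_digraph \<Rightarrow> 'a set \<Rightarrow> ('a, 'b) pre_digraph" where
  "delete_vertices G S = G \<restriction> (verts G - S)"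

text \<open>
  For a graph with at least one vertex the set below is nonempty, as it contains the
  order of the graph (take \<open>S = verts G\<close>).
\<close>

definition strong_domination_stability :: "('a, 'b) pre_digraph \<Rightarrow> nat" where
  "strong_domination_stability G =
     Min {card S | S. S \<subseteq> verts G \<and>
       strong_domination_number (delete_vertices G S) \<noteq> strong_domination_number G}"

end

theory Submission
  imports Defs
begin

text \<open>
  If \<open>m < n\<close>, the vertices in the part of size \<open>m\<close> have degree \<open>n\<close> and those in the other part
  have the smaller degree \<open>m\<close>. The former can thus be strongly dominated only by themselves, and
  they dominate everything else, so the strong domination number is \<open>m\<close>. Deleting one of them
  lowers it to \<open>m - 1\<close>. In the balanced graph two adjacent vertices suffice, whereas deleting a
  vertex leaves the unbalanced graph with parts of sizes \<open>n - 1 \<ge> 3\<close> and \<open>n\<close>.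
\<close>

text \<open>Well-formedness puts both ends of every arc in \<open>verts G\<close>, so restricting to
  all vertices loses no arc.\<close>

lemma (in wf_digraph) delete_vertices_empty [simp]: "delete_vertices G {} = G"
  by (rule pre_digraph.equality) (auto simp: delete_vertices_def)

lemma (in graph) graph_delete_vertices: "graph (delete_vertices G S)"
proof -
  have *: "induced_subgraph (delete_vertices G S) G"
    unfolding delete_vertices_def by (rule induced_induce) simp
  then interpret H: digraph "delete_vertices G S"
    by (rule digraphI_induced)
  show ?thesis
    using induced_graph_imp_symmetric[OF sym_arcs *] by (rule H.graphI)
qed

lemma arcs_ends_delete_vertices:
  "arcs_ends (delete_vertices G S) = arcs_ends G \<inter> (verts G - S) \<times> (verts G - S)"
  by (auto simp: delete_vertices_def arcs_ends_conv)

text \<open>Finiteness is what gives the \<open>Min\<close> in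
  \<open>strong_domination_number\<close> its intended meaning.\<close>

lemma (in fin_digraph) finite_strong_dominating_sets: "finite {D. strong_dominating_set G D}"
  by (rule finite_subset[of _ "Pow (verts G)"]) (auto simp: strong_dominating_set_def)

lemma (in fin_digraph) strong_domination_number_le:
  assumes "strong_dominating_set G D"
  shows "strong_domination_number G \<le> card D"
  unfolding strong_domination_number_def
  using assms finite_strong_dominating_sets by (auto intro: Min_le)

lemma (in fin_digraph) strong_domination_number_eqI:
  assumes "strong_dominating_set G D" and "\<And>D'. strong_dominating_set G D' \<Longrightarrow> card D \<le> card D'"
  shows "strong_domination_number G = card D"
  unfolding strong_domination_number_def
  using assms finite_strong_dominating_sets by (auto intro!: Min_eqI)

text \<open>Deleting nothing leaves \<open>G\<close> as it is, so a set that changes the number is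
  nonempty and has size at least 1; the singleton \<open>{v}\<close> attains this bound.\<close>

lemma (in fin_digraph) strong_domination_stability_eq_1I:
  assumes "v \<in> verts G"
    and "strong_domination_number (delete_vertices G {v}) \<noteq> strong_domination_number G"
  shows "strong_domination_stability G = 1"
  unfolding strong_domination_stability_def
proof (rule Min_eqI)
  have "{S. S \<subseteq> verts G \<and>
      strong_domination_number (delete_vertices G S) \<noteq> strong_domination_number G} \<subseteq> Pow (verts G)"
    by auto
  then show "finite {card S | S. S \<subseteq> verts G \<and>
      strong_domination_number (delete_vertices G S) \<noteq> strong_domination_number G}"
    using finite_subset by fastforce
  show "1 \<in> {card S | S. S \<subseteq> verts G \<and>
      strong_domination_number (delete_vertices G S) \<noteq> strong_domination_number G}"
    using assms by (auto intro!: exI[of _ "{v}"])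
next
  fix k
  assume "k \<in> {card S | S. S \<subseteq> verts G \<and>
      strong_domination_number (delete_vertices G S) \<noteq> strong_domination_number G}"
  then obtain S where S: "k = card S" "S \<subseteq> verts G"
      "strong_domination_number (delete_vertices G S) \<noteq> strong_domination_number G"
    by auto
  then have "S \<noteq> {}" "finite S"
    by (auto intro: finite_subset)
  then show "1 \<le> k"
    using S by (simp add: Suc_le_eq card_gt_0_iff)
qed

text \<open>The neighbourhood of a vertex is the whole opposite part, which yields the
  degrees.\<close>

lemma complete_bipartite_digraphE:
  assumes "K\<^bsub>m,n\<^esub> G"
  obtains U V where "graph G" "verts G = U \<union> V" "U \<inter> V = {}" "finite U" "finite V"
    "card U = m" "card V = n" "arcs_ends G = U \<times> V \<union> V \<times> U"
    "\<And>u. u \<in> U \<Longrightarrow> out_degree G u = n" "\<And>v. v \<in> V \<Longrightarrow> out_degree G v = m"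
proof -
  obtain U V where *: "graph G" "verts G = U \<union> V" "U \<inter> V = {}" "card U = m" "card V = n"
      "arcs_ends G = U \<times> V \<union> V \<times> U"
    using assms unfolding complete_bipartite_digraph_def by blast
  interpret graph G by fact
  have "finite U" "finite V"
    using finite_verts *(2) by auto
  moreover have "{w. u \<rightarrow>\<^bsub>G\<^esub> w} = V" if "u \<in> U" for u
    using that * by auto
  moreover have "{w. v \<rightarrow>\<^bsub>G\<^esub> w} = U" if "v \<in> V" for v
    using that * by auto
  ultimately show thesis
    using that[of U V] * by (simp add: out_degree_eq_card_neighbours)
qed

lemma complete_bipartite_digraph_delete_vertex:
  assumes "K\<^bsub>Suc m,n\<^esub> G"
  obtains v where "v \<in> verts G" "K\<^bsub>m,n\<^esub> (delete_vertices G {v})"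
proof -
  obtain U V where UV: "graph G" "verts G = U \<union> V" "U \<inter> V = {}" "finite U"
      "card U = Suc m" "card V = n" "arcs_ends G = U \<times> V \<union> V \<times> U"
    using assms by (rule complete_bipartite_digraphE)
  then obtain v where v: "v \<in> U"
    by fastforce
  have "verts (delete_vertices G {v}) = (U - {v}) \<union> V"
    using UV v by (auto simp: delete_vertices_def)
  moreover have "arcs_ends (delete_vertices G {v}) = (U - {v}) \<times> V \<union> V \<times> (U - {v})"
    using UV v by (auto simp: arcs_ends_delete_vertices)
  moreover have "(U - {v}) \<inter> V = {}" "card (U - {v}) = m"
    using UV v by auto
  ultimately have "K\<^bsub>m,n\<^esub> (delete_vertices G {v})"
    unfolding complete_bipartite_digraph_def
    using UV(6) graph.graph_delete_vertices[OF UV(1)] by blast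
  then show thesis
    using that v UV(2) by blast
qed

lemma strong_domination_number_complete_bipartite:
  assumes "K\<^bsub>m,n\<^esub> G" "0 < m" "m < n"
  shows "strong_domination_number G = m"
proof -
  obtain U V where UV: "graph G" "verts G = U \<union> V" "U \<inter> V = {}" "finite U" "finite V"
      "card U = m" "card V = n" "arcs_ends G = U \<times> V \<union> V \<times> U"
      "\<And>u. u \<in> U \<Longrightarrow> out_degree G u = n" "\<And>v. v \<in> V \<Longrightarrow> out_degree G v = m"
    using assms(1) by (rule complete_bipartite_digraphE) blast
  interpret graph G by fact
  \<comment> \<open>This \<open>u\<close> dominates all of \<open>V\<close>, as its degree
    \<open>n\<close> exceeds \<open>m\<close>; it exists because \<open>0 < m\<close>.\<close>
  obtain u where "u \<in> U"
    using UV(6) assms(2) by fastforce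
  then have "strong_dominating_set G U"
    using UV assms by (auto simp: strong_dominating_set_def intro!: bexI[of _ u])
  moreover have "card U \<le> card D" if D: "strong_dominating_set G D" for D
  proof (rule card_mono)
    show "finite D"
      using D UV by (auto simp: strong_dominating_set_def intro: finite_subset)
    show "U \<subseteq> D"
    proof
      fix u assume u: "u \<in> U"
      show "u \<in> D"
      proof (rule ccontr)
        \<comment> \<open>A dominator \<open>w\<close> of \<open>u\<close> is a neighbour, so it
          lies in \<open>V\<close> and has degree \<open>m < n\<close>, too small for
          \<open>u\<close>.\<close>
        assume "u \<notin> D"
        then obtain w where "u \<rightarrow>\<^bsub>G\<^esub> w" "out_degree G u \<le> out_degree G w"
          using D u UV(2) unfolding strong_dominating_set_def by blast
        then show False
          using u UV assms(3) by auto
      qed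
    qed
  qed
  ultimately show ?thesis
    using strong_domination_number_eqI UV(6) by blast
qed

text \<open>All degrees are equal, so strong domination is plain domination, and one vertex from
  each part dominates the other part. The upper bound is enough to separate this value from that of
  the reduced graph.\<close>

lemma strong_domination_number_complete_bipartite_balanced_le:
  assumes "K\<^bsub>n,n\<^esub> G" "0 < n"
  shows "strong_domination_number G \<le> 2"
proof -
  obtain U V where UV: "graph G" "verts G = U \<union> V" "U \<inter> V = {}" "finite U" "finite V"
      "card U = n" "card V = n" "arcs_ends G = U \<times> V \<union> V \<times> U"
      "\<And>u. u \<in> U \<Longrightarrow> out_degree G u = n" "\<And>v. v \<in> V \<Longrightarrow> out_degree G v = n"
    using assms(1) by (rule complete_bipartite_digraphE) blast
  interpret graph G by fact
  obtain u v where uv: "u \<in> U" "v \<in> V"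
    using UV(6,7) assms(2) by fastforce
  then have "strong_dominating_set G {u, v}"
    using UV by (auto simp: strong_dominating_set_def)
  then have "strong_domination_number G \<le> card {u, v}"
    by (rule strong_domination_number_le)
  also have "\<dots> \<le> 2"
    by (simp add: card_insert_if)
  finally show ?thesis .
qed

theorem proposition2p8:
  fixes G :: "('a, 'b) pre_digraph" and m n :: nat
  assumes "K\<^bsub>m,n\<^esub> G" and "1 < m" and "m \<le> n"
  shows "(m < n \<longrightarrow> strong_domination_stability G = 1) \<and>
         (m = n \<and> n \<ge> 4 \<longrightarrow> strong_domination_stability G = 1)"
proof -
  interpret graph G
    using assms(1) by (simp add: complete_bipartite_digraph_def)
  have "K\<^bsub>Suc (m - 1),n\<^esub> G"
    using assms(1,2) by simp
  then obtain v where v: "v \<in> verts G" "K\<^bsub>m - 1,n\<^esub> (delete_vertices G {v})"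
    by (rule complete_bipartite_digraph_delete_vertex)
  \<comment> \<open>Both cases share this value: \<open>m \<le> n\<close> gives
    \<open>m - 1 < n\<close> even when \<open>m = n\<close>, and \<open>1 < m\<close> keeps the
    smaller part nonempty.\<close>
  have del: "strong_domination_number (delete_vertices G {v}) = m - 1"
    using v(2) assms(2,3) by (intro strong_domination_number_complete_bipartite) auto
  have "strong_domination_number G \<noteq> m - 1" if "m < n"
    using strong_domination_number_complete_bipartite[OF assms(1)] assms(2) that by simp
  \<comment> \<open>Here \<open>n \<ge> 4\<close> enters: \<open>m - 1\<close> is at least 3, above
    the bound 2.\<close>
  moreover have "strong_domination_number G \<noteq> m - 1" if "m = n" "n \<ge> 4"
    using strong_domination_number_complete_bipartite_balanced_le[of n G] assms(1) that by auto
  ultimately show ?thesis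
    using strong_domination_stability_eq_1I[OF v(1)] del by auto
qed

end
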